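(* For $n\geq1$, $$L_{n+1}^E(x)=2nxL_n^E(x)+2x(1-x)\frac{d}{dx}L_n^E(x)+xL_n^O(x),$$ $$L_{n+1}^O(x)=((2n-1)x+1)L_n^O(x)+2x(1-x)\frac{d}{dx}L_n^O(x)+L_n^E(x),$$ with $L_1^E(x)=0$ and $L_1^O(x)=1$.
   Context: A Stirling permutation of order $n$ is a permutation $\sigma=\sigma_1\sigma_2\cdots\sigma_{2n}$ of the multiset $\{1,1,2,2,\ldots,n,n\}$ such that for each $i$, all entries between the two occurrences of $i$ are larger than $i$; $\mathcal{Q}_n$ denotes the set of these. The ascent-plateau number is ${\rm ap}(\sigma)=\#\{i\in[2,2n-1]:\sigma_{i-1}<\sigma_i=\sigma_{i+1}\}$. Let $\mathcal{Q}_n^+=\{\sigma\in\mathcal{Q}_n:\sigma_1<\sigma_2\}$, $\mathcal{Q}_n^-=\{\sigma\in\mathcal{Q}_n:\sigma_1=\sigma_2\}$, $L_n^E(x)=\sum_{\sigma\in\mathcal{Q}_n^+}x^{{\rm ap}(\sigma)}$ and $L_n^O(x)=\sum_{\sigma\in\mathcal{Q}_n^-}x^{{\rm ap}(\sigma)}$. (Equivalently, with ${\rm fap}(\sigma)=2{\rm ap}(\sigma)+1$ if $\sigma_1=\sigma_2$ and $2{\rm ap}(\sigma)$ otherwise, $\sum_{\sigma\in\mathcal{Q}_n}x^{{\rm fap}(\sigma)}=L_n^E(x^2)+xL_n^O(x^2)$.) *)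

theory Defs
  imports "HOL-Combinatorics.Multiset_Permutations" "HOL-Computational_Algebra.Polynomial"
begin

text \<open>
  Words are lists, so the letter written \<open>\<sigma>\<^sub>i\<close> with indices from 1 is \<open>\<sigma> ! (i - 1)\<close>.
  Each value occurs exactly twice, so positions \<open>i < k\<close> carrying equal entries are
  the two occurrences of that value.
\<close>

definition stirling_perms :: "nat \<Rightarrow> nat list set" where
  "stirling_perms n =
     {\<sigma> \<in> permutations_of_multiset (\<Sum>i\<in>{1..n}. {#i, i#}).
        \<forall>i j k. i < j \<longrightarrow> j < k \<longrightarrow> k < length \<sigma> \<longrightarrow> \<sigma> ! i = \<sigma> ! k \<longrightarrow> \<sigma> ! i < \<sigma> ! j}"

definition ap :: "nat list \<Rightarrow> nat" where
  "ap \<sigma> = card {i \<in> {2..length \<sigma> - 1}. \<sigma> ! (i - 2) < \<sigma> ! (i - 1) \<and> \<sigma> ! (i - 1) = \<sigma> ! i}"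

definition stirling_perms_plus :: "nat \<Rightarrow> nat list set" where
  "stirling_perms_plus n = {\<sigma> \<in> stirling_perms n. \<sigma> ! 0 < \<sigma> ! 1}"

definition stirling_perms_minus :: "nat \<Rightarrow> nat list set" where
  "stirling_perms_minus n = {\<sigma> \<in> stirling_perms n. \<sigma> ! 0 = \<sigma> ! 1}"

definition L_E :: "nat \<Rightarrow> int poly" where
  "L_E n = (\<Sum>\<sigma>\<in>stirling_perms_plus n. monom 1 (ap \<sigma>))"

definition L_O :: "nat \<Rightarrow> int poly" where
  "L_O n = (\<Sum>\<sigma>\<in>stirling_perms_minus n. monom 1 (ap \<sigma>))"

lemma finite_stirling_perms: "finite (stirling_perms n)"
  unfolding stirling_perms_def by simp

end

theory Submission
  imports Defs
begin

text \<open>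
  In a Stirling permutation of order \<open>n + 1\<close> the two largest letters are adjacent, so it arises
  from a unique Stirling permutation \<open>\<sigma>\<close> of order \<open>n\<close> by inserting a block of them into one of the
  \<open>2 n + 1\<close> gaps. Insertion at the front keeps the ascent-plateau number. Any other
  insertion creates one new ascent-plateau and destroys an old one exactly when the gap lies
  inside it; since ascent-plateaus have no gap in common, this happens for \<open>2 ap(\<sigma>)\<close> gaps.
  Only the first two gaps influence the comparison of the first two letters.
\<close>

section \<open>Insertion of a block of two equal letters into a word\<close>

definition insert_pair :: "'a \<Rightarrow> nat \<Rightarrow> 'a list \<Rightarrow> 'a list" where
  "insert_pair a p \<sigma> = take p \<sigma> @ [a, a] @ drop p \<sigma>"

text \<open>The new position of the letter formerly at position \<open>i\<close> once a block enters
  gap \<open>p\<close>. The map is strictly increasing, and its range omits exactly \<open>p\<close>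
  and \<open>p + 1\<close>, the positions of the block.\<close>

definition shift_pos :: "nat \<Rightarrow> nat \<Rightarrow> nat" where
  "shift_pos p i = (if i < p then i else i + 2)"

text \<open>Indexed by the zero-based position of the lower letter in front of the plateau. This is
  the index set of \<open>ap\<close> shifted by 2, so no truncated subtraction occurs.\<close>

definition ascent_plateaus :: "nat list \<Rightarrow> nat set" where
  "ascent_plateaus \<sigma> =
     {i. i + 2 < length \<sigma> \<and> \<sigma> ! i < \<sigma> ! (i + 1) \<and> \<sigma> ! (i + 1) = \<sigma> ! (i + 2)}"

text \<open>Gap \<open>p\<close> lies just before position \<open>p\<close>, so a triple starting at
  \<open>i\<close> has the two inner gaps \<open>i + 1\<close> and \<open>i + 2\<close>.\<close>

definition plateau_gaps :: "nat list \<Rightarrow> nat set" where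
  "plateau_gaps \<sigma> = (\<lambda>i. i + 1) ` ascent_plateaus \<sigma> \<union> (\<lambda>i. i + 2) ` ascent_plateaus \<sigma>"

definition stirling_word :: "nat list \<Rightarrow> bool" where
  "stirling_word \<sigma> \<longleftrightarrow>
     (\<forall>i j k. i < j \<longrightarrow> j < k \<longrightarrow> k < length \<sigma> \<longrightarrow> \<sigma> ! i = \<sigma> ! k \<longrightarrow> \<sigma> ! i < \<sigma> ! j)"

lemma length_insert_pair [simp]: "length (insert_pair a p \<sigma>) = length \<sigma> + 2"
  by (simp add: insert_pair_def)

lemma mset_insert_pair: "mset (insert_pair a p \<sigma>) = mset \<sigma> + {#a, a#}"
proof -
  have "mset \<sigma> = mset (take p \<sigma>) + mset (drop p \<sigma>)"
    by (metis append_take_drop_id mset_append)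
  then show ?thesis by (simp add: insert_pair_def)
qed

lemma nth_insert_pair:
  assumes "p \<le> length \<sigma>" "i < length \<sigma> + 2"
  shows "insert_pair a p \<sigma> ! i =
    (if i < p then \<sigma> ! i else if i < p + 2 then a else \<sigma> ! (i - 2))"
proof -
  consider "i < p" | "i = p" | "i = Suc p" | "i \<ge> p + 2" by linarith
  then show ?thesis
    using assms by cases (auto simp: insert_pair_def nth_append nth_Cons split: nat.splits
        intro!: arg_cong[where f = "(!) \<sigma>"])
qed

lemma nth_insert_pair_shift_pos:
  assumes "p \<le> length \<sigma>" "i < length \<sigma>"
  shows "insert_pair a p \<sigma> ! shift_pos p i = \<sigma> ! i"
  using assms by (auto simp: nth_insert_pair shift_pos_def)

lemma shift_pos_less_iff [simp]: "shift_pos p i < shift_pos p j \<longleftrightarrow> i < j"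
  by (auto simp: shift_pos_def)

lemma inj_shift_pos: "inj (shift_pos p)"
  by (auto simp: inj_def shift_pos_def split: if_splits)

lemma shift_pos_less_length: "p \<le> l \<Longrightarrow> shift_pos p i < Suc (Suc l) \<longleftrightarrow> i < l"
  by (auto simp: shift_pos_def)

lemma shift_pos_cases:
  obtains "k = p" | "k = p + 1" | i where "k = shift_pos p i"
proof -
  consider "k < p" | "k = p" | "k = p + 1" | "k \<ge> p + 2" by linarith
  then show ?thesis
  proof cases
    case 1
    then show ?thesis using that(3)[of k] by (simp add: shift_pos_def)
  next
    case 4
    then have "k = shift_pos p (k - 2)" by (auto simp: shift_pos_def)
    then show ?thesis by (rule that(3))
  qed (use that in auto)
qed

text \<open>Old triples keep their order under \<open>shift_pos\<close>. Conversely, the copies of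
  \<open>a\<close> are adjacent and larger than all old letters: no letter separates them, neither
  equals an old letter, and between two equal old letters they satisfy the condition.\<close>

lemma stirling_word_insert_pair:
  assumes p: "p \<le> length \<sigma>" and less: "\<forall>x\<in>set \<sigma>. x < a"
  shows "stirling_word (insert_pair a p \<sigma>) \<longleftrightarrow> stirling_word \<sigma>"
proof
  let ?\<tau> = "insert_pair a p \<sigma>"
  assume \<tau>: "stirling_word ?\<tau>"
  show "stirling_word \<sigma>"
    unfolding stirling_word_def
  proof (intro allI impI)
    fix i j k assume *: "i < j" "j < k" "k < length \<sigma>" "\<sigma> ! i = \<sigma> ! k"
    then have "?\<tau> ! shift_pos p i < ?\<tau> ! shift_pos p j"
      using \<tau>[unfolded stirling_word_def, rule_format,
          of "shift_pos p i" "shift_pos p j" "shift_pos p k"] p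
      by (simp add: nth_insert_pair_shift_pos shift_pos_less_length)
    then show "\<sigma> ! i < \<sigma> ! j"
      using * p by (simp add: nth_insert_pair_shift_pos)
  qed
next
  let ?\<tau> = "insert_pair a p \<sigma>"
  assume \<sigma>: "stirling_word \<sigma>"
  have at: "?\<tau> ! p = a" "?\<tau> ! (p + 1) = a"
    using p by (simp_all add: nth_insert_pair)
  have old: "?\<tau> ! shift_pos p m = \<sigma> ! m \<and> \<sigma> ! m < a" if "m < length \<sigma>" for m
    using p that less by (simp add: nth_insert_pair_shift_pos)
  show "stirling_word ?\<tau>"
    unfolding stirling_word_def
  proof (intro allI impI)
    fix i j k assume *: "i < j" "j < k" "k < length ?\<tau>" "?\<tau> ! i = ?\<tau> ! k"
    have "\<exists>i'. i = shift_pos p i'"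
    proof (rule ccontr)
      assume "\<not> ?thesis"
      then have i: "i = p \<or> i = p + 1" by (metis shift_pos_cases)
      \<comment> \<open>With \<open>j\<close> strictly between \<open>i\<close> and
        \<open>k\<close>, position \<open>k\<close> lies beyond both copies of \<open>a\<close> and
        carries a smaller old letter.\<close>
      then have "k \<ge> p + 2" using * by linarith
      then obtain k' where k': "k = shift_pos p k'"
        by (cases rule: shift_pos_cases[of k p]) auto
      then have "k' < length \<sigma>" using *(3) p by (simp add: shift_pos_less_length)
      with old[of k'] k' i at *(4) show False by auto
    qed
    then obtain i' where i': "i = shift_pos p i'" by blast
    from * have "i < length \<sigma> + 2" by simp
    then have i'l: "i' < length \<sigma>" using p i' by (simp add: shift_pos_less_length)
    have "\<exists>k'. k = shift_pos p k'"
    proof (rule ccontr)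
      assume "\<not> ?thesis"
      then have "k = p \<or> k = p + 1" by (metis shift_pos_cases)
      with at *(4) old[OF i'l] i' show False by auto
    qed
    then obtain k' where k': "k = shift_pos p k'" by blast
    have k'l: "k' < length \<sigma>" using *(3) p k' by (simp add: shift_pos_less_length)
    show "?\<tau> ! i < ?\<tau> ! j"
    proof (cases "\<exists>j'. j = shift_pos p j'")
      case True
      then obtain j' where j': "j = shift_pos p j'" by blast
      have "i' < j'" "j' < k'" using * i' j' k' by simp_all
      moreover have "\<sigma> ! i' = \<sigma> ! k'" using *(4) i' k' old[OF i'l] old[OF k'l] by simp
      ultimately have "\<sigma> ! i' < \<sigma> ! j'"
        using \<sigma> k'l unfolding stirling_word_def by blast
      then show ?thesis using old[OF i'l] old[of j'] i' j' \<open>j' < k'\<close> k'l by simp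
    next
      case False
      then have "j = p \<or> j = p + 1" by (metis shift_pos_cases)
      then show ?thesis using at old[OF i'l] i' by auto
    qed
  qed
qed

section \<open>The effect of an insertion on ascent-plateaus\<close>

lemma finite_ascent_plateaus: "finite (ascent_plateaus \<sigma>)"
  by (rule finite_subset[of _ "{..<length \<sigma>}"]) (auto simp: ascent_plateaus_def)

lemma ap_eq_card_ascent_plateaus: "ap \<sigma> = card (ascent_plateaus \<sigma>)"
proof -
  have "{i \<in> {2..length \<sigma> - 1}. \<sigma> ! (i - 2) < \<sigma> ! (i - 1) \<and> \<sigma> ! (i - 1) = \<sigma> ! i}
      = (\<lambda>i. i + 2) ` ascent_plateaus \<sigma>" (is "?L = ?R")
  proof (intro equalityI subsetI)
    fix i assume "i \<in> ?L"
    moreover from this obtain m where "i = m + 2"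
      by (metis (no_types, lifting) add.commute atLeastAtMost_iff le_Suc_ex mem_Collect_eq)
    ultimately show "i \<in> ?R" by (auto simp: ascent_plateaus_def)
  qed (auto simp: ascent_plateaus_def)
  moreover have "card ((\<lambda>i. i + 2) ` ascent_plateaus \<sigma>) = card (ascent_plateaus \<sigma>)"
    by (intro card_image inj_onI) simp
  ultimately show ?thesis unfolding ap_def by simp
qed

text \<open>A triple survives unless the block splits it at an inner gap. The block itself is a
  plateau, and any letter in front of it is smaller, which gives the new start \<open>p - 1\<close>
  unless \<open>p = 0\<close>.\<close>

lemma ascent_plateaus_insert_pair:
  assumes p: "p \<le> length \<sigma>" and less: "\<forall>x\<in>set \<sigma>. x < a"
  shows "ascent_plateaus (insert_pair a p \<sigma>) =
    shift_pos p ` {i \<in> ascent_plateaus \<sigma>. p \<noteq> i + 1 \<and> p \<noteq> i + 2} \<union>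
    (if p = 0 then {} else {p - 1})" (is "?L = ?R")
proof (rule set_eqI)
  fix i
  have less': "\<sigma> ! m < a" if "m < length \<sigma>" for m using less that by simp
  \<comment> \<open>The cases say how the triple at \<open>i\<close> meets the block: before it,
    ending in its first copy, ending in both copies, starting at the first copy, starting at the
    second, or after it.\<close>
  consider "i + 2 < p" | "i + 2 = p" | "i + 1 = p" | "i = p" | "i = p + 1" | "i \<ge> p + 2"
    by linarith
  then show "i \<in> ?L \<longleftrightarrow> i \<in> ?R"
  proof cases
    case 1
    then have "i \<in> ?L \<longleftrightarrow> i \<in> ascent_plateaus \<sigma>"
      using p by (auto simp: ascent_plateaus_def nth_insert_pair)
    moreover have "i \<in> ?R \<longleftrightarrow> i \<in> ascent_plateaus \<sigma>"
      using 1 by (auto simp: shift_pos_def image_iff split: if_splits)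
    ultimately show ?thesis by simp
  next
    case 2
    then show ?thesis using p less'[of "i + 1"]
      by (auto simp: ascent_plateaus_def nth_insert_pair shift_pos_def)
  next
    case 3
    then show ?thesis using p less'[of i]
      by (auto simp: ascent_plateaus_def nth_insert_pair shift_pos_def)
  next
    case 4
    then show ?thesis using p
      by (auto simp: ascent_plateaus_def nth_insert_pair shift_pos_def)
  next
    case 5
    have "i \<notin> ?L"
    proof
      assume "i \<in> ?L"
      then have "p < length \<sigma>" "insert_pair a p \<sigma> ! (p + 1) < insert_pair a p \<sigma> ! (p + 2)"
        using 5 by (auto simp: ascent_plateaus_def)
      then show False using p less'[of p] by (simp add: nth_insert_pair)
    qed
    then show ?thesis using 5 by (auto simp: shift_pos_def)
  next
    case 6
    define m where "m = i - 2"
    have m: "i = m + 2" "m \<ge> p" using 6 by (simp_all add: m_def)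
    then have "i \<in> ?L \<longleftrightarrow> m \<in> ascent_plateaus \<sigma>"
      using p by (auto simp: ascent_plateaus_def nth_insert_pair)
    moreover have "i \<in> ?R \<longleftrightarrow> m \<in> ascent_plateaus \<sigma>"
      using m by (auto simp: shift_pos_def image_iff split: if_splits)
    ultimately show ?thesis by simp
  qed
qed

lemma ap_insert_pair:
  assumes p: "p \<le> length \<sigma>" and less: "\<forall>x\<in>set \<sigma>. x < a"
  shows "ap (insert_pair a p \<sigma>) = (if p = 0 \<or> p \<in> plateau_gaps \<sigma> then ap \<sigma> else Suc (ap \<sigma>))"
proof -
  let ?A = "ascent_plateaus \<sigma>"
  let ?K = "{i \<in> ?A. p \<noteq> i + 1 \<and> p \<noteq> i + 2}"
  have fin: "finite ?A" "finite ?K" by (simp_all add: finite_ascent_plateaus)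
  have card_K: "card (shift_pos p ` ?K) = card ?K"
    by (intro card_image inj_on_subset[OF inj_shift_pos]) simp
  show ?thesis
  proof (cases "p = 0")
    case True
    then show ?thesis using card_K ascent_plateaus_insert_pair[OF assms]
      by (simp add: ap_eq_card_ascent_plateaus)
  next
    case False
    \<comment> \<open>Only \<open>i = p - 1\<close> could be sent there, and it is excluded by
      \<open>p \<noteq> i + 1\<close>.\<close>
    have "p - 1 \<notin> shift_pos p ` ?K"
      using False by (auto simp: shift_pos_def)
    then have ap_\<tau>: "ap (insert_pair a p \<sigma>) = Suc (card ?K)"
      using False fin card_K
      by (simp add: ap_eq_card_ascent_plateaus ascent_plateaus_insert_pair[OF assms])
    show ?thesis
    proof (cases "p \<in> plateau_gaps \<sigma>")
      case True
      then obtain i where i: "i \<in> ?A" "p = i + 1 \<or> p = i + 2"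
        by (auto simp: plateau_gaps_def)
      \<comment> \<open>Starts at neighbouring positions are impossible: the later one needs a
        strict ascent where the earlier one has its plateau. Hence the gap \<open>p\<close>
        determines \<open>i\<close>.\<close>
      have "?K = ?A - {i}"
        using i by (auto simp: ascent_plateaus_def)
      then show ?thesis
        using ap_\<tau> True i(1) fin
        by (simp add: ap_eq_card_ascent_plateaus card_Suc_Diff1 del: card_Diff_insert)
    next
      case gap: False
      then have "?K = ?A" by (auto simp: plateau_gaps_def)
      then show ?thesis
        using ap_\<tau> gap False by (simp add: ap_eq_card_ascent_plateaus)
    qed
  qed
qed

text \<open>Since no two starts are neighbours, the first inner gaps and the second inner gaps form
  disjoint sets.\<close>

lemma card_plateau_gaps: "card (plateau_gaps \<sigma>) = 2 * ap \<sigma>"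
proof -
  let ?A = "ascent_plateaus \<sigma>"
  have "(\<lambda>i. i + 1) ` ?A \<inter> (\<lambda>i. i + 2) ` ?A = {}"
    by (auto simp: ascent_plateaus_def)
  moreover have "card ((\<lambda>i. i + c) ` ?A) = card ?A" for c
    by (intro card_image inj_onI) simp
  ultimately show ?thesis
    unfolding plateau_gaps_def ap_eq_card_ascent_plateaus
    by (subst card_Un_disjoint) (simp_all only: finite_imageI finite_ascent_plateaus mult_2)
qed

lemma plateau_gaps_subset: "plateau_gaps \<sigma> \<subseteq> {1..length \<sigma>}"
  by (auto simp: plateau_gaps_def ascent_plateaus_def)

text \<open>Gap 1 can only be inside a triple starting at position 0. Used in contrapositive form
  for words with equal first letters.\<close>

lemma one_in_plateau_gapsD: "1 \<in> plateau_gaps \<sigma> \<Longrightarrow> \<sigma> ! 0 < \<sigma> ! 1"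
  by (auto simp: plateau_gaps_def ascent_plateaus_def)

section \<open>The structure of Stirling permutations: removing the largest letters, and the two
  classes\<close>

lemma stirling_perms_iff:
  "\<sigma> \<in> stirling_perms n \<longleftrightarrow> mset \<sigma> = (\<Sum>i\<in>{1..n}. {#i, i#}) \<and> stirling_word \<sigma>"
  by (auto simp: stirling_perms_def stirling_word_def permutations_of_multiset_def)

lemma set_stirling_perms: "\<sigma> \<in> stirling_perms n \<Longrightarrow> set \<sigma> = {1..n}"
proof -
  assume "\<sigma> \<in> stirling_perms n"
  then have "set_mset (mset \<sigma>) = set_mset (\<Sum>i\<in>{1..n}. {#i, i#})"
    by (simp add: stirling_perms_iff)
  then show ?thesis by (auto simp: set_mset_sum)
qed

lemma length_stirling_perms: "\<sigma> \<in> stirling_perms n \<Longrightarrow> length \<sigma> = 2 * n"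
proof -
  assume "\<sigma> \<in> stirling_perms n"
  then have "size (mset \<sigma>) = size (\<Sum>i\<in>{1..n}. {#i, i#})"
    by (simp add: stirling_perms_iff)
  then show ?thesis by (simp add: size_multiset_sum)
qed

lemma less_Suc_stirling_perms: "\<sigma> \<in> stirling_perms n \<Longrightarrow> \<forall>x\<in>set \<sigma>. x < Suc n"
  by (auto simp: set_stirling_perms)

lemma insert_pair_stirling_perms:
  assumes "\<sigma> \<in> stirling_perms n" "p \<le> 2 * n"
  shows "insert_pair (Suc n) p \<sigma> \<in> stirling_perms (Suc n)"
  using assms
    stirling_word_insert_pair[OF _ less_Suc_stirling_perms[OF assms(1)], of p]
  by (simp add: length_stirling_perms stirling_perms_iff mset_insert_pair add.commute)

text \<open>A letter between the two copies of \<open>Suc n\<close> would have to exceed the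
  maximum, so the copies are adjacent and can be cut out as a block.\<close>

lemma stirling_perms_Suc_insert_pair:
  assumes \<tau>: "\<tau> \<in> stirling_perms (Suc n)"
  obtains \<sigma> p where "\<sigma> \<in> stirling_perms n" "p \<le> 2 * n" "\<tau> = insert_pair (Suc n) p \<sigma>"
proof -
  let ?N = "Suc n"
  have m\<tau>: "mset \<tau> = (\<Sum>i\<in>{1..n}. {#i, i#}) + {#?N, ?N#}" and w: "stirling_word \<tau>"
    using \<tau> by (simp_all add: stirling_perms_iff add.commute)
  have "?N \<in> set \<tau>" using set_stirling_perms[OF \<tau>] by simp
  then obtain u r where ur: "\<tau> = u @ ?N # r" "?N \<notin> set u" by (metis split_list_first)
  have "mset u + mset r = (\<Sum>i\<in>{1..n}. {#i, i#}) + {#?N#}"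
    using m\<tau> ur by simp
  then have "?N \<in># mset u + mset r" by simp
  then have "?N \<in> set r" using ur by simp
  then obtain v r' where r: "r = v @ ?N # r'" "?N \<notin> set v" by (metis split_list_first)
  have "v = []"
  proof (rule ccontr)
    assume "v \<noteq> []"
    then obtain b v' where v: "v = b # v'" by (cases v) auto
    \<comment> \<open>The two copies of \<open>?N\<close> stand at \<open>length u\<close> and
      \<open>length u + 1 + length v\<close>, with \<open>b\<close> right after the first.\<close>
    have "\<tau> ! length u < \<tau> ! (length u + 1)"
      using w[unfolded stirling_word_def, rule_format,
          of "length u" "length u + 1" "length u + 1 + length v"]
      by (simp add: ur r v nth_append)
    then have "?N < b" by (simp add: ur r v nth_append)
    moreover have "b \<in> {1..?N}"
      using set_stirling_perms[OF \<tau>] by (auto simp: ur r v)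
    ultimately show False by simp
  qed
  then have \<tau>_eq: "\<tau> = insert_pair ?N (length u) (u @ r')"
    by (simp add: insert_pair_def ur r)
  have m: "mset (u @ r') = (\<Sum>i\<in>{1..n}. {#i, i#})"
    using m\<tau> by (simp add: \<tau>_eq mset_insert_pair)
  have "set_mset (mset (u @ r')) = {1..n}"
    unfolding m by (auto simp: set_mset_sum)
  then have "\<forall>x\<in>set (u @ r'). x < ?N"
    by (metis set_mset_mset atLeastAtMost_iff less_Suc_eq_le)
  then have "u @ r' \<in> stirling_perms n"
    using m w stirling_word_insert_pair[of "length u" "u @ r'" ?N]
    by (simp add: stirling_perms_iff \<tau>_eq)
  moreover from this have "length u \<le> 2 * n"
    using length_stirling_perms by fastforce
  ultimately show ?thesis using that \<tau>_eq by blast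
qed

text \<open>Both arguments can be read off the result: deleting every \<open>a\<close> recovers the
  word, and the length of the longest prefix without \<open>a\<close> recovers the gap.\<close>

lemma insert_pair_eqD:
  assumes "a \<notin> set \<sigma>" "a \<notin> set \<tau>" "p \<le> length \<sigma>" "q \<le> length \<tau>"
    and eq: "insert_pair a p \<sigma> = insert_pair a q \<tau>"
  shows "\<sigma> = \<tau> \<and> p = q"
proof -
  have id: "filter (\<lambda>x. x \<noteq> a) \<rho> = \<rho>" if "a \<notin> set \<rho>" for \<rho>
    using that by (auto simp: filter_id_conv)
  have filt: "filter (\<lambda>x. x \<noteq> a) (insert_pair a r \<rho>) = \<rho>" if "a \<notin> set \<rho>" for r \<rho>
  proof -
    have "filter (\<lambda>x. x \<noteq> a) (insert_pair a r \<rho>) = filter (\<lambda>x. x \<noteq> a) (take r \<rho> @ drop r \<rho>)"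
      by (simp add: insert_pair_def del: append_take_drop_id)
    then show ?thesis using id[OF that] by simp
  qed
  have len: "length (takeWhile (\<lambda>x. x \<noteq> a) (insert_pair a r \<rho>)) = r"
    if "a \<notin> set \<rho>" "r \<le> length \<rho>" for r \<rho>
  proof -
    have "\<forall>x\<in>set (take r \<rho>). x \<noteq> a" using that(1) by (auto dest: in_set_takeD)
    then show ?thesis using that(2)
      by (simp add: insert_pair_def takeWhile_append2)
  qed
  show ?thesis using assms filt len by metis
qed

lemma bij_betw_insert_pair:
  "bij_betw (\<lambda>(\<sigma>, p). insert_pair (Suc n) p \<sigma>) (stirling_perms n \<times> {..2 * n})
     (stirling_perms (Suc n))"
  unfolding bij_betw_def
proof
  show "inj_on (\<lambda>(\<sigma>, p). insert_pair (Suc n) p \<sigma>) (stirling_perms n \<times> {..2 * n})"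
  proof -
    have "\<sigma> = \<tau> \<and> p = q"
      if "\<sigma> \<in> stirling_perms n" "\<tau> \<in> stirling_perms n" "p \<le> 2 * n" "q \<le> 2 * n"
        "insert_pair (Suc n) p \<sigma> = insert_pair (Suc n) q \<tau>" for \<sigma> \<tau> p q
      by (rule insert_pair_eqD[of "Suc n"])
        (use that in \<open>simp_all add: set_stirling_perms length_stirling_perms\<close>)
    then show ?thesis by (auto simp: inj_on_def)
  qed
  show "(\<lambda>(\<sigma>, p). insert_pair (Suc n) p \<sigma>) ` (stirling_perms n \<times> {..2 * n}) =
      stirling_perms (Suc n)"
  proof (intro equalityI subsetI)
    fix \<tau> assume "\<tau> \<in> stirling_perms (Suc n)"
    then show "\<tau> \<in> (\<lambda>(\<sigma>, p). insert_pair (Suc n) p \<sigma>) ` (stirling_perms n \<times> {..2 * n})"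
      by (elim stirling_perms_Suc_insert_pair) force
  qed (auto intro: insert_pair_stirling_perms)
qed

text \<open>If the first letter exceeded the second, the latter would separate the two occurrences of
  the former.\<close>

lemma stirling_perms_plus_Un_minus:
  assumes "n \<ge> 1"
  shows "stirling_perms n = stirling_perms_plus n \<union> stirling_perms_minus n"
proof -
  have "\<sigma> ! 0 \<le> \<sigma> ! 1" if \<sigma>: "\<sigma> \<in> stirling_perms n" for \<sigma>
  proof (rule ccontr)
    assume gt: "\<not> ?thesis"
    have "length \<sigma> \<ge> 2" using length_stirling_perms[OF \<sigma>] assms by simp
    then obtain a b r where abr: "\<sigma> = a # b # r"
      by (metis One_nat_def Suc_1 Suc_le_length_iff)
    have "a \<in> {1..n}" using set_stirling_perms[OF \<sigma>] by (auto simp: abr)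
    then have "count (mset \<sigma>) a = 2"
      using \<sigma> by (simp add: stirling_perms_iff count_sum if_distrib if_distribR sum.If_cases)
    \<comment> \<open>By \<open>gt\<close> the second letter differs from \<open>a\<close>, so the
      other occurrence of \<open>a\<close> lies in \<open>r\<close>.\<close>
    then have "count (mset r) a > 0" using gt by (simp add: abr split: if_splits)
    then have "a \<in> set r" by (metis count_greater_zero_iff set_mset_mset)
    then obtain k where k: "k < length r" "r ! k = a" by (metis in_set_conv_nth)
    have "stirling_word \<sigma>" using \<sigma> by (simp add: stirling_perms_iff)
    then have "\<sigma> ! 0 < \<sigma> ! 1"
      using k unfolding stirling_word_def
      by (elim allE[of _ 0] allE[of _ 1] allE[of _ "k + 2"]) (simp add: abr)
    with gt show False by simp
  qed
  then show ?thesis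
    by (auto simp: stirling_perms_plus_def stirling_perms_minus_def le_less)
qed

lemma plus_Int_minus: "stirling_perms_plus n \<inter> stirling_perms_minus n = {}"
  by (auto simp: stirling_perms_plus_def stirling_perms_minus_def)

lemma finite_stirling_perms_plus [simp]: "finite (stirling_perms_plus n)"
  by (simp add: stirling_perms_plus_def finite_stirling_perms)

lemma finite_stirling_perms_minus [simp]: "finite (stirling_perms_minus n)"
  by (simp add: stirling_perms_minus_def finite_stirling_perms)

section \<open>The generating polynomials of order \<open>Suc n\<close> as sums over
  insertions\<close>

lemma first_two_insert_pair:
  assumes "\<sigma> \<in> stirling_perms n" "n \<ge> 1" "p \<le> 2 * n"
  shows "insert_pair (Suc n) p \<sigma> ! 0 = (if p = 0 then Suc n else \<sigma> ! 0)"
    and "insert_pair (Suc n) p \<sigma> ! 1 = (if p \<le> 1 then Suc n else \<sigma> ! 1)"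
    and "\<sigma> ! 0 < Suc n"
proof -
  show "\<sigma> ! 0 < Suc n"
    using less_Suc_stirling_perms[OF assms(1)] length_stirling_perms[OF assms(1)] assms(2) by simp
qed (use assms in \<open>auto simp: nth_insert_pair length_stirling_perms\<close>)

text \<open>Reindexing along the insertion bijection. \<open>P\<close> will be either of the two
  comparisons of the first two letters.\<close>

lemma sum_stirling_perms_Suc:
  "(\<Sum>\<tau> | \<tau> \<in> stirling_perms (Suc n) \<and> P \<tau>. monom 1 (ap \<tau>) :: int poly) =
   (\<Sum>(\<sigma>, p) | \<sigma> \<in> stirling_perms n \<and> p \<le> 2 * n \<and> P (insert_pair (Suc n) p \<sigma>).
      monom 1 (ap (insert_pair (Suc n) p \<sigma>)))"
proof -
  let ?f = "\<lambda>(\<sigma>, p). insert_pair (Suc n) p \<sigma>"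
  let ?S = "{(\<sigma>, p). \<sigma> \<in> stirling_perms n \<and> p \<le> 2 * n \<and> P (insert_pair (Suc n) p \<sigma>)}"
  have img: "{\<tau> \<in> stirling_perms (Suc n). P \<tau>} = ?f ` ?S"
    using bij_betw_imp_surj_on[OF bij_betw_insert_pair[of n], symmetric] by force
  have "inj_on ?f ?S"
    by (rule inj_on_subset[OF bij_betw_imp_inj_on[OF bij_betw_insert_pair]]) auto
  then show ?thesis
    unfolding img by (simp add: sum.reindex case_prod_unfold)
qed

text \<open>Gap 0 makes the first two letters equal and drops out, gap 1 puts the maximum second and
  always gives an ascent, and later gaps preserve the class of the word.\<close>

lemma L_E_Suc:
  assumes "n \<ge> 1"
  shows "L_E (Suc n) =
    (\<Sum>\<sigma>\<in>stirling_perms_plus n. \<Sum>p\<in>{1..2 * n}. monom 1 (ap (insert_pair (Suc n) p \<sigma>))) +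
    (\<Sum>\<sigma>\<in>stirling_perms_minus n. monom 1 (ap (insert_pair (Suc n) 1 \<sigma>)))"
proof -
  have "{(\<sigma>, p). \<sigma> \<in> stirling_perms n \<and> p \<le> 2 * n \<and>
          insert_pair (Suc n) p \<sigma> ! 0 < insert_pair (Suc n) p \<sigma> ! 1}
      = stirling_perms_plus n \<times> {1..2 * n} \<union> stirling_perms_minus n \<times> {1}" (is "?S = ?T")
  proof -
    have "(\<sigma>, p) \<in> ?S \<longleftrightarrow> (\<sigma>, p) \<in> ?T" for \<sigma> p
    proof (cases "\<sigma> \<in> stirling_perms n \<and> p \<le> 2 * n")
      case True
      then have "\<sigma> \<in> stirling_perms_plus n \<or> \<sigma> \<in> stirling_perms_minus n"
        using stirling_perms_plus_Un_minus[OF assms] by blast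
      then show ?thesis
        using assms True first_two_insert_pair[of \<sigma> n p]
        by (auto simp: stirling_perms_plus_def stirling_perms_minus_def)
    next
      case False
      then show ?thesis
        using assms by (auto simp: stirling_perms_plus_def stirling_perms_minus_def)
    qed
    then show ?thesis by auto
  qed
  moreover have "stirling_perms_plus n \<times> {1..2 * n} \<inter> stirling_perms_minus n \<times> {1} = {}"
    using plus_Int_minus by blast
  ultimately show ?thesis
    unfolding L_E_def stirling_perms_plus_def[of "Suc n"] sum_stirling_perms_Suc
    by (simp add: sum.union_disjoint flip: sum.cartesian_product)
qed

text \<open>The complementary insertions: gap 0 is admissible for every word, gap 1 for none, and
  later gaps only for words already beginning with two equal letters.\<close>

lemma L_O_Suc:
  assumes "n \<ge> 1"
  shows "L_O (Suc n) =
    (\<Sum>\<sigma>\<in>stirling_perms_minus n. \<Sum>p\<in>{2..2 * n}. monom 1 (ap (insert_pair (Suc n) p \<sigma>))) +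
    (\<Sum>\<sigma>\<in>stirling_perms n. monom 1 (ap (insert_pair (Suc n) 0 \<sigma>)))"
proof -
  have "{(\<sigma>, p). \<sigma> \<in> stirling_perms n \<and> p \<le> 2 * n \<and>
          insert_pair (Suc n) p \<sigma> ! 0 = insert_pair (Suc n) p \<sigma> ! 1}
      = stirling_perms_minus n \<times> {2..2 * n} \<union> stirling_perms n \<times> {0}" (is "?S = ?T")
  proof -
    have "(\<sigma>, p) \<in> ?S \<longleftrightarrow> (\<sigma>, p) \<in> ?T" for \<sigma> p
    proof (cases "\<sigma> \<in> stirling_perms n \<and> p \<le> 2 * n")
      case True
      then show ?thesis
        using assms first_two_insert_pair[of \<sigma> n p]
        by (auto simp: stirling_perms_minus_def)
    next
      case False
      then show ?thesis
        by (auto simp: stirling_perms_minus_def)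
    qed
    then show ?thesis by auto
  qed
  moreover have "stirling_perms_minus n \<times> {2..2 * n} \<inter> stirling_perms n \<times> {0} = {}"
    by auto
  ultimately show ?thesis
    unfolding L_O_def stirling_perms_minus_def[of "Suc n"] sum_stirling_perms_Suc
    by (simp add: sum.union_disjoint finite_stirling_perms flip: sum.cartesian_product)
qed

section \<open>Monomials and derivatives\<close>

lemma X_times_monom: "[:0, 1:] * monom (c :: int) k = monom c (Suc k)"
  by (simp add: monom_Suc)

text \<open>The Euler operator turns an exponent into a factor; this is how counts of plateau gaps
  become derivatives.\<close>

lemma X_times_pderiv_monom: "[:0, 1:] * pderiv (monom (1 :: int) k) = of_nat k * monom 1 k"
  \<comment> \<open>For \<open>k = 0\<close> the exponent \<open>k - 1\<close> is truncated, but the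
    coefficient vanishes.\<close>
  unfolding pderiv_monom X_times_monom by (cases k) (simp_all add: of_nat_poly smult_monom)

lemma pderiv_sum_poly: "pderiv (\<Sum>x\<in>A. f x) = (\<Sum>x\<in>A. pderiv (f x))"
  using higher_pderiv_sum[of 1 f A] by simp

text \<open>With \<open>s = card S\<close>, the sum is
  \<open>2k x^k + (s - 2k) x^(k+1) = s x x^k + 2 (1 - x) k x^k\<close>, and \<open>k x^k\<close> is
  \<open>x\<close> times the derivative of \<open>x^k\<close>. Here \<open>S\<close> stands for the
  admissible gaps and \<open>B\<close> for the plateau gaps.\<close>

lemma sum_monom_gaps:
  assumes "finite S" "B \<subseteq> S" "card B = 2 * k"
  shows "(\<Sum>p\<in>S. monom 1 (if p \<in> B then k else Suc k) :: int poly) =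
    [:0, int (card S):] * monom 1 k + [:0, 2:] * [:1, -1:] * pderiv (monom 1 k)"
proof -
  let ?X = "[:0, 1:] :: int poly" and ?m = "monom 1 k :: int poly"
  have "finite B" using assms finite_subset by blast
  then have card_diff: "int (card (S - B)) = int (card S) - 2 * int k"
    using assms card_mono[of S B] by (simp add: card_Diff_subset of_nat_diff)
  have "(\<Sum>p\<in>S. monom 1 (if p \<in> B then k else Suc k) :: int poly) =
      (\<Sum>p\<in>B. monom 1 k) + (\<Sum>p\<in>S - B. monom 1 (Suc k))"
    using assms by (subst sum.subset_diff[of B S]) (simp_all add: add.commute)
  also have "\<dots> = of_int (2 * int k) * ?m + of_int (int (card (S - B))) * (?X * ?m)"
    unfolding X_times_monom using assms(3) by simp
  also have "\<dots> = of_int (int (card S)) * ?X * ?m + 2 * (1 - ?X) * (of_nat k * ?m)"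
    unfolding card_diff by (simp add: algebra_simps)
  also have "\<dots> = of_int (int (card S)) * ?X * ?m + 2 * ?X * (1 - ?X) * pderiv ?m"
    unfolding X_times_pderiv_monom[symmetric] by (simp only: ac_simps)
  also have "of_int (int (card S)) * ?X = [:0, int (card S):]"
    by (simp add: of_nat_poly)
  also have "2 * ?X * (1 - ?X) = [:0, 2:] * [:1, -1:]"
    by (simp add: numeral_poly one_pCons)
  finally show ?thesis .
qed

section \<open>The two recurrences\<close>

lemma L_E_recurrence:
  assumes "n \<ge> 1"
  shows "L_E (Suc n) =
    [:0, 2 * int n:] * L_E n + [:0, 2:] * [:1, -1:] * pderiv (L_E n) + [:0, 1:] * L_O n"
proof -
  have plus: "(\<Sum>p\<in>{1..2 * n}. monom 1 (ap (insert_pair (Suc n) p \<sigma>))) =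
      [:0, 2 * int n:] * monom 1 (ap \<sigma>) + [:0, 2:] * [:1, -1:] * pderiv (monom 1 (ap \<sigma>))"
    if "\<sigma> \<in> stirling_perms_plus n" for \<sigma>
  proof -
    have \<sigma>: "\<sigma> \<in> stirling_perms n" using that by (simp add: stirling_perms_plus_def)
    have "(\<Sum>p\<in>{1..2 * n}. monom 1 (ap (insert_pair (Suc n) p \<sigma>)) :: int poly) =
        (\<Sum>p\<in>{1..2 * n}. monom 1 (if p \<in> plateau_gaps \<sigma> then ap \<sigma> else Suc (ap \<sigma>)))"
      using less_Suc_stirling_perms[OF \<sigma>] length_stirling_perms[OF \<sigma>]
      by (intro sum.cong) (simp_all add: ap_insert_pair)
    also have "\<dots> = [:0, int (card {1..2 * n}):] * monom 1 (ap \<sigma>) +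
        [:0, 2:] * [:1, -1:] * pderiv (monom 1 (ap \<sigma>))"
      using plateau_gaps_subset[of \<sigma>] length_stirling_perms[OF \<sigma>]
      by (intro sum_monom_gaps) (simp_all add: card_plateau_gaps)
    finally show ?thesis by simp
  qed
  have minus: "monom 1 (ap (insert_pair (Suc n) 1 \<sigma>)) = [:0, 1:] * monom (1 :: int) (ap \<sigma>)"
    if "\<sigma> \<in> stirling_perms_minus n" for \<sigma>
  proof -
    have \<sigma>: "\<sigma> \<in> stirling_perms n" using that by (simp add: stirling_perms_minus_def)
    \<comment> \<open>Equal first letters leave no ascent at position 0, so insertion at gap 1
      destroys nothing and contributes a factor \<open>x\<close>.\<close>
    have "1 \<notin> plateau_gaps \<sigma>"
      using that one_in_plateau_gapsD[of \<sigma>] by (auto simp: stirling_perms_minus_def)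
    then show ?thesis
      unfolding X_times_monom
      using ap_insert_pair[of 1 \<sigma> "Suc n"] less_Suc_stirling_perms[OF \<sigma>]
        length_stirling_perms[OF \<sigma>] assms by simp
  qed
  have "L_E (Suc n) =
      (\<Sum>\<sigma>\<in>stirling_perms_plus n. [:0, 2 * int n:] * monom 1 (ap \<sigma>) +
         [:0, 2:] * [:1, -1:] * pderiv (monom 1 (ap \<sigma>))) +
      (\<Sum>\<sigma>\<in>stirling_perms_minus n. [:0, 1:] * monom 1 (ap \<sigma>))"
    unfolding L_E_Suc[OF assms] by (intro arg_cong2[where f = "(+)"] sum.cong refl plus minus)
  then show ?thesis
    unfolding L_E_def[of n] L_O_def pderiv_sum_poly sum_distrib_left sum.distrib .
qed

lemma L_O_recurrence:
  assumes "n \<ge> 1"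
  shows "L_O (Suc n) =
    [:1, 2 * int n - 1:] * L_O n + [:0, 2:] * [:1, -1:] * pderiv (L_O n) + L_E n"
proof -
  have minus: "(\<Sum>p\<in>{2..2 * n}. monom 1 (ap (insert_pair (Suc n) p \<sigma>))) =
      [:0, 2 * int n - 1:] * monom 1 (ap \<sigma>) + [:0, 2:] * [:1, -1:] * pderiv (monom 1 (ap \<sigma>))"
    if "\<sigma> \<in> stirling_perms_minus n" for \<sigma>
  proof -
    have \<sigma>: "\<sigma> \<in> stirling_perms n" using that by (simp add: stirling_perms_minus_def)
    have "1 \<notin> plateau_gaps \<sigma>"
      using that one_in_plateau_gapsD[of \<sigma>] by (auto simp: stirling_perms_minus_def)
    moreover have "plateau_gaps \<sigma> \<subseteq> {1..2 * n}"
      using plateau_gaps_subset[of \<sigma>] length_stirling_perms[OF \<sigma>] by simp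
    moreover have "{2..2 * n} = {1..2 * n} - {1}" by auto
    \<comment> \<open>Dropping gap 1 loses no plateau gap, so all \<open>2 * ap \<sigma>\<close> of
      them remain among the \<open>2 * n - 1\<close> admissible gaps.\<close>
    ultimately have sub: "plateau_gaps \<sigma> \<subseteq> {2..2 * n}" by blast
    have "(\<Sum>p\<in>{2..2 * n}. monom 1 (ap (insert_pair (Suc n) p \<sigma>)) :: int poly) =
        (\<Sum>p\<in>{2..2 * n}. monom 1 (if p \<in> plateau_gaps \<sigma> then ap \<sigma> else Suc (ap \<sigma>)))"
      using less_Suc_stirling_perms[OF \<sigma>] length_stirling_perms[OF \<sigma>]
      by (intro sum.cong) (simp_all add: ap_insert_pair)
    also have "\<dots> = [:0, int (card {2..2 * n}):] * monom 1 (ap \<sigma>) +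
        [:0, 2:] * [:1, -1:] * pderiv (monom 1 (ap \<sigma>))"
      using sub by (intro sum_monom_gaps) (simp_all add: card_plateau_gaps)
    also have "int (card {2..2 * n}) = 2 * int n - 1" using assms by (simp add: of_nat_diff)
    finally show ?thesis .
  qed
  have front: "monom 1 (ap (insert_pair (Suc n) 0 \<sigma>)) = monom (1 :: int) (ap \<sigma>)"
    if "\<sigma> \<in> stirling_perms n" for \<sigma>
    using ap_insert_pair[of 0 \<sigma> "Suc n"] less_Suc_stirling_perms[OF that] by simp
  have total: "(\<Sum>\<sigma>\<in>stirling_perms n. monom 1 (ap \<sigma>)) = L_E n + L_O n"
    unfolding L_E_def L_O_def stirling_perms_plus_Un_minus[OF assms]
    by (rule sum.union_disjoint) (simp_all add: plus_Int_minus)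
  have "L_O (Suc n) =
      (\<Sum>\<sigma>\<in>stirling_perms_minus n. [:0, 2 * int n - 1:] * monom 1 (ap \<sigma>) +
         [:0, 2:] * [:1, -1:] * pderiv (monom 1 (ap \<sigma>))) +
      (\<Sum>\<sigma>\<in>stirling_perms n. monom 1 (ap \<sigma>))"
    unfolding L_O_Suc[OF assms] by (intro arg_cong2[where f = "(+)"] sum.cong refl minus front)
  also have "\<dots> = ([:0, 2 * int n - 1:] * L_O n + [:0, 2:] * [:1, -1:] * pderiv (L_O n)) +
      (L_E n + L_O n)"
    unfolding total unfolding L_O_def pderiv_sum_poly sum_distrib_left sum.distrib ..
  \<comment> \<open>The constant coefficient 1 of the final factor is supplied by the summand
    \<open>L_O n\<close> coming from insertions at the front.\<close>
  also have "[:0, 2 * int n - 1:] = [:1, 2 * int n - 1:] - 1"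
    by (simp add: one_pCons)
  also have "(c - 1) * b + d + (e + b) = c * b + d + e" for b c d e :: "int poly"
    by (simp add: algebra_simps)
  finally show ?thesis .
qed

section \<open>The initial values at order one\<close>

lemma stirling_perms_1: "stirling_perms 1 = {[1, 1]}"
proof -
  have "\<sigma> \<in> stirling_perms 1 \<longleftrightarrow> \<sigma> = [1, 1]" for \<sigma>
  proof
    assume \<sigma>: "\<sigma> \<in> stirling_perms 1"
    have "replicate (length \<sigma>) 1 = \<sigma>"
      using set_stirling_perms[OF \<sigma>] by (intro replicate_length_same) simp
    then show "\<sigma> = [1, 1]"
      using length_stirling_perms[OF \<sigma>] by (simp add: numeral_2_eq_2)
  qed (simp add: stirling_perms_iff stirling_word_def)
  then show ?thesis by blast
qed

lemma L_E_1: "L_E 1 = 0"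
proof -
  have "stirling_perms_plus 1 = {}"
    unfolding stirling_perms_plus_def stirling_perms_1 by auto
  then show ?thesis by (simp add: L_E_def)
qed

lemma L_O_1: "L_O 1 = 1"
proof -
  have "stirling_perms_minus 1 = {[1, 1]}"
    unfolding stirling_perms_minus_def stirling_perms_1 by auto
  \<comment> \<open>For a word of length 2 the index range in \<open>ap\<close> is
    \<open>{2..1}\<close>, which is empty, so the only monomial is 1.\<close>
  then show ?thesis by (simp add: L_O_def ap_def)
qed

theorem theorem2p5:
  shows "(\<forall>n\<ge>1.
      L_E (n + 1) = [:0, 2 * int n:] * L_E n + [:0, 2:] * [:1, -1:] * pderiv (L_E n) + [:0, 1:] * L_O n
    \<and> L_O (n + 1) = [:1, 2 * int n - 1:] * L_O n + [:0, 2:] * [:1, -1:] * pderiv (L_O n) + L_E n)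
    \<and> L_E 1 = 0 \<and> L_O 1 = 1"
  using L_E_recurrence L_O_recurrence L_E_1 L_O_1 by (simp only: Suc_eq_plus1) blast

end
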